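(* Let $A$ be a function algebra (over the complex scalars) which is weakly Hahn-Banach smooth. Then $A$ is (linearly) isometric to $\ell^{\infty}(n)$ for some positive integer $n$.
   Context: A function algebra is a closed, point-separating subalgebra, containing the constants, of $C(\Omega)$ (complex-valued continuous functions with the supremum norm) for some (nonempty) compact Hausdorff space $\Omega$. For a Banach space $X$, let $S_X$ be its unit sphere and $X^\ast$ its dual. $X$ is weakly Hahn-Banach smooth if every norm-attaining functional $x^\ast\in S_{X^\ast}$ (i.e. $x^\ast(x)=1$ for some $x\in S_X$) is a point of weak$^\ast$-weak continuity for the identity map on $S_{X^\ast}$; that is, the identity map from $S_{X^\ast}$ with the weak$^\ast$ topology $\sigma(X^\ast,X)$ to $S_{X^\ast}$ with the weak topology $\sigma(X^\ast,X^{\ast\ast})$ is continuous at $x^\ast$. $\ell^\infty(n)$ denotes $\mathbb{C}^n$ with the maximum norm. *)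

theory Defs
  imports "HOL-Analysis.Analysis"
begin

(* A complex normed space is given by its carrier set and its operations, so that a space,
   its dual and its bidual are all treated by the same definitions. *)
record 'v cnspace =
  vcarrier :: "'v set"
  vadd :: "'v \<Rightarrow> 'v \<Rightarrow> 'v"
  vscale :: "complex \<Rightarrow> 'v \<Rightarrow> 'v"
  vnorm :: "'v \<Rightarrow> real"

definition unit_sphere :: "'v cnspace \<Rightarrow> 'v set" where
  "unit_sphere X = {x \<in> vcarrier X. vnorm X x = 1}"

(* Functionals are extensional, that is undefined outside the carrier, so that two of them
   are equal as soon as they agree on the carrier. *)
definition dual_carrier :: "'v cnspace \<Rightarrow> ('v \<Rightarrow> complex) set" where
  "dual_carrier X = {\<phi> \<in> extensional (vcarrier X).
     (\<forall>x \<in> vcarrier X. \<forall>y \<in> vcarrier X. \<phi> (vadd X x y) = \<phi> x + \<phi> y) \<and>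
     (\<forall>c. \<forall>x \<in> vcarrier X. \<phi> (vscale X c x) = c * \<phi> x) \<and>
     (\<exists>K. \<forall>x \<in> vcarrier X. cmod (\<phi> x) \<le> K * vnorm X x)}"

definition dual :: "'v cnspace \<Rightarrow> ('v \<Rightarrow> complex) cnspace" where
  "dual X = \<lparr>
     vcarrier = dual_carrier X,
     vadd = (\<lambda>\<phi> \<psi>. \<lambda>x \<in> vcarrier X. \<phi> x + \<psi> x),
     vscale = (\<lambda>c \<phi>. \<lambda>x \<in> vcarrier X. c * \<phi> x),
     vnorm = (\<lambda>\<phi>. SUP x \<in> {x \<in> vcarrier X. vnorm X x \<le> 1}. cmod (\<phi> x))\<rparr>"

definition weak_topology :: "'v cnspace \<Rightarrow> 'v topology" where
  "weak_topology X =
     pullback_topology (vcarrier X) (\<lambda>x. \<lambda>\<phi> \<in> vcarrier (dual X). \<phi> x)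
       (product_topology (\<lambda>_. euclidean) (vcarrier (dual X)))"

(* The topology of pointwise convergence on X, carried by the dual of X. *)
definition weak_star_topology :: "'v cnspace \<Rightarrow> ('v \<Rightarrow> complex) topology" where
  "weak_star_topology X =
     subtopology (product_topology (\<lambda>_. euclidean) (vcarrier X)) (vcarrier (dual X))"

definition norm_attaining :: "'v cnspace \<Rightarrow> ('v \<Rightarrow> complex) \<Rightarrow> bool" where
  "norm_attaining X \<phi> \<longleftrightarrow> (\<exists>x \<in> unit_sphere X. \<phi> x = 1)"

definition weakly_Hahn_Banach_smooth :: "'v cnspace \<Rightarrow> bool" where
  "weakly_Hahn_Banach_smooth X \<longleftrightarrow>
     (\<forall>\<phi> \<in> unit_sphere (dual X). norm_attaining X \<phi> \<longrightarrow>
        topcontinuous_at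
          (subtopology (weak_star_topology X) (unit_sphere (dual X)))
          (subtopology (weak_topology (dual X)) (unit_sphere (dual X)))
          id \<phi>)"

definition linearly_isometric :: "'v cnspace \<Rightarrow> 'w cnspace \<Rightarrow> bool" where
  "linearly_isometric X Y \<longleftrightarrow>
     (\<exists>T. bij_betw T (vcarrier X) (vcarrier Y) \<and>
        (\<forall>x \<in> vcarrier X. \<forall>y \<in> vcarrier X. T (vadd X x y) = vadd Y (T x) (T y)) \<and>
        (\<forall>c. \<forall>x \<in> vcarrier X. T (vscale X c x) = vscale Y c (T x)) \<and>
        (\<forall>x \<in> vcarrier X. vnorm Y (T x) = vnorm X x))"

(* Meaningful for n > 0 only: otherwise the norm is the maximum of an empty set. *)
definition ell_infinity :: "nat \<Rightarrow> (nat \<Rightarrow> complex) cnspace" where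
  "ell_infinity n = \<lparr>
     vcarrier = extensional {..<n},
     vadd = (\<lambda>x y. \<lambda>i \<in> {..<n}. x i + y i),
     vscale = (\<lambda>c x. \<lambda>i \<in> {..<n}. c * x i),
     vnorm = (\<lambda>x. Max ((\<lambda>i. cmod (x i)) ` {..<n}))\<rparr>"

definition bcont_mult ::
  "('a::topological_space \<Rightarrow>\<^sub>C complex) \<Rightarrow> ('a \<Rightarrow>\<^sub>C complex) \<Rightarrow> ('a \<Rightarrow>\<^sub>C complex)" where
  "bcont_mult f g = Bcontfun (\<lambda>x. f x * g x)"

lemma apply_bcont_mult [simp]: "apply_bcontfun (bcont_mult f g) x = f x * g x"
proof -
  have "(\<lambda>x. f x * g x) \<in> bcontfun"
  proof (rule bcontfun_normI)
    show "continuous_on UNIV (\<lambda>x. f x * g x)"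
      by (intro continuous_intros) auto
    show "cmod (f x * g x) \<le> norm f * norm g" for x
      by (auto simp: norm_mult intro!: mult_mono norm_bounded)
  qed
  then show ?thesis
    by (simp add: bcont_mult_def Bcontfun_inverse)
qed

definition bcont_scale :: "complex \<Rightarrow> ('a::topological_space \<Rightarrow>\<^sub>C complex) \<Rightarrow> ('a \<Rightarrow>\<^sub>C complex)" where
  "bcont_scale c f = bcont_mult (const_bcontfun c) f"

lemma apply_bcont_scale [simp]: "apply_bcontfun (bcont_scale c f) x = c * f x"
  by (simp add: bcont_scale_def const_bcontfun.rep_eq)

(* On a compact space every continuous function is bounded, so that the type of bounded
   continuous functions is C(Omega) with the supremum norm, and closed refers to that norm. *)
definition function_algebra :: "('a::t2_space \<Rightarrow>\<^sub>C complex) set \<Rightarrow> bool" where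
  "function_algebra A \<longleftrightarrow>
     compact (UNIV :: 'a set) \<and>
     closed A \<and>
     (\<forall>f \<in> A. \<forall>g \<in> A. f + g \<in> A) \<and>
     (\<forall>c. \<forall>f \<in> A. bcont_scale c f \<in> A) \<and>
     (\<forall>f \<in> A. \<forall>g \<in> A. bcont_mult f g \<in> A) \<and>
     (\<forall>c. const_bcontfun c \<in> A) \<and>
     (\<forall>x y. x \<noteq> y \<longrightarrow> (\<exists>f \<in> A. f x \<noteq> f y))"

definition sup_norm_space :: "('a::topological_space \<Rightarrow>\<^sub>C complex) set \<Rightarrow> ('a \<Rightarrow>\<^sub>C complex) cnspace" where
  "sup_norm_space A =
     \<lparr>vcarrier = A, vadd = (+), vscale = bcont_scale, vnorm = norm\<rparr>"

end

(* Let f in A have sup norm at most 1 and satisfy f = 1 wherever |f| = 1. A weak* cluster point F of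
   the powers of f in the bidual takes the value 1 at the point evaluations of the peak set {f = 1}
   and 0 at all others. Point evaluations attain their norm at the constant 1, so smoothness makes
   x |-> F(evaluation at x) continuous: the peak set is clopen, and the powers of f converge
   uniformly to its indicator, which therefore lies in A. Summing 2^-k times indicators shows
   that the sets with indicator in A are closed under countable unions; since they are also
   clopen, compactness forbids infinite strictly descending chains. A minimal such set containing
   a given point is a singleton, as a set with two points can be split by the peak set of a
   suitable element of A. So Omega is finite and A is the algebra of all functions on it. *)
theory Submission
  imports Defs
begin

section \<open>Cluster points in the bidual\<close>

text \<open>Tychonoff: the sequence lives in a product of closed discs, hence has a cluster point
  \<open>L\<close>. The index type may be uncountable, so a convergent subsequence need not exist;
  the filter \<open>G\<close> serves as a subnet.\<close>

lemma bounded_sequence_pointwise_subnet: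
  fixes u :: "nat \<Rightarrow> 'i \<Rightarrow> complex"
  assumes bnd: "\<And>n i. cmod (u n i) \<le> C i"
  obtains L G where "G \<noteq> bot" "G \<le> sequentially" "\<And>i. ((\<lambda>n. u n i) \<longlongrightarrow> L i) G"
proof -
  let ?P = "PiE UNIV (\<lambda>i. cball (0::complex) (C i))"
  have "compactin (product_topology (\<lambda>_. euclidean) UNIV) ?P"
    by (simp add: compactin_PiE)
  then have "compact ?P"
    by (simp add: euclidean_product_topology)
  moreover have "eventually (\<lambda>v. v \<in> ?P) (filtermap u sequentially)"
    using bnd by (simp add: eventually_filtermap PiE_iff)
  moreover have "filtermap u sequentially \<noteq> bot"
    by (simp add: filtermap_bot_iff)
  ultimately obtain L where L: "inf (nhds L) (filtermap u sequentially) \<noteq> bot"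
    unfolding compact_filter by blast
  \<comment> \<open>Generated by the tails of the sequence and the indices n with \<open>u n\<close>
    near \<open>L\<close>. It is nontrivial because no neighbourhood of the cluster point
    \<open>L\<close> is eventually avoided.\<close>
  define G where "G = inf sequentially (filtercomap u (nhds L))"
  have "G \<noteq> bot"
  proof
    assume "G = bot"
    then obtain P Q where "eventually P sequentially" and Q: "eventually Q (nhds L)"
      and PQ: "\<And>n. P n \<Longrightarrow> Q (u n) \<Longrightarrow> False"
      unfolding G_def trivial_limit_def eventually_inf eventually_filtercomap by blast
    have "eventually (\<lambda>v. \<not> Q v) (filtermap u sequentially)"
      unfolding eventually_filtermap
      using \<open>eventually P sequentially\<close> by (rule eventually_mono) (use PQ in blast)
    with Q have "eventually (\<lambda>_. False) (inf (nhds L) (filtermap u sequentially))"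
      unfolding eventually_inf by blast
    with L show False
      by (simp add: trivial_limit_def)
  qed
  moreover have "G \<le> sequentially"
    by (simp add: G_def)
  moreover have "((\<lambda>n. u n i) \<longlongrightarrow> L i) G" for i
  proof -
    have "(u \<longlongrightarrow> L) G"
      unfolding G_def filterlim_def by (simp add: filtermap_le_iff_le_filtercomap)
    moreover have "continuous_on UNIV (\<lambda>v::'i \<Rightarrow> complex. v i)"
      by (rule continuous_on_product_coordinates)
    ultimately show ?thesis
      using continuous_on_tendsto_compose[of UNIV "\<lambda>v. v i" u L G] by simp
  qed
  ultimately show thesis
    using that by blast
qed

lemma dual_simps [simp]:
  "vcarrier (dual X) = dual_carrier X"
  "vadd (dual X) \<phi> \<psi> = (\<lambda>x \<in> vcarrier X. \<phi> x + \<psi> x)"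
  "vscale (dual X) c \<phi> = (\<lambda>x \<in> vcarrier X. c * \<phi> x)"
  "vnorm (dual X) \<phi> = (SUP x \<in> {x \<in> vcarrier X. vnorm X x \<le> 1}. cmod (\<phi> x))"
  by (simp_all add: dual_def)

text \<open>The supremum defining the dual norm is informative only over a set that is bounded
  above; boundedness of the functional supplies this.\<close>

lemma norm_le_dual_norm:
  assumes nonneg: "\<And>x. x \<in> vcarrier X \<Longrightarrow> 0 \<le> vnorm X x"
    and "\<phi> \<in> dual_carrier X" and x: "x \<in> vcarrier X" "vnorm X x \<le> 1"
  shows "cmod (\<phi> x) \<le> vnorm (dual X) \<phi>"
proof -
  obtain K where K: "\<And>x. x \<in> vcarrier X \<Longrightarrow> cmod (\<phi> x) \<le> K * vnorm X x"
    using assms(2) unfolding dual_carrier_def by blast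
  \<comment> \<open>The absolute value is needed because \<open>K\<close> may be negative if all
    norms vanish.\<close>
  have "cmod (\<phi> y) \<le> \<bar>K\<bar>" if "y \<in> vcarrier X" "vnorm X y \<le> 1" for y
  proof -
    have "cmod (\<phi> y) \<le> \<bar>K\<bar> * vnorm X y"
      using K[OF that(1)] nonneg[OF that(1)] by (smt (verit) mult_right_mono)
    also have "\<dots> \<le> \<bar>K\<bar> * 1"
      using that by (intro mult_left_mono) auto
    finally show ?thesis by simp
  qed
  then have "bdd_above ((\<lambda>x. cmod (\<phi> x)) ` {x \<in> vcarrier X. vnorm X x \<le> 1})"
    by (intro bdd_aboveI2) auto
  then show ?thesis
    using x by (auto intro!: cSUP_upper)
qed

text \<open>Banach-Alaoglu in the bidual, for a sequence from the unit ball of X. Linearity and the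
  norm bound pass to limits along \<open>G\<close>, since \<open>G\<close> is nontrivial and limits
  in the complex plane are unique.\<close>

lemma bidual_cluster_point:
  fixes X :: "'v cnspace"
  assumes nonneg: "\<And>x. x \<in> vcarrier X \<Longrightarrow> 0 \<le> vnorm X x"
    and add: "\<And>x y. x \<in> vcarrier X \<Longrightarrow> y \<in> vcarrier X \<Longrightarrow> vadd X x y \<in> vcarrier X"
    and scale: "\<And>c x. x \<in> vcarrier X \<Longrightarrow> vscale X c x \<in> vcarrier X"
    and v: "\<And>n. v n \<in> vcarrier X" "\<And>n. vnorm X (v n) \<le> 1"
  obtains F G where "F \<in> dual_carrier (dual X)" "G \<noteq> bot" "G \<le> sequentially"
    "\<And>\<phi>. \<phi> \<in> dual_carrier X \<Longrightarrow> ((\<lambda>n::nat. \<phi> (v n)) \<longlongrightarrow> F \<phi>) G"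
proof -
  \<comment> \<open>Extended by 0 so that the family is bounded at every index of the type, not just
    at functionals in the dual.\<close>
  define u where "u n \<phi> = (if \<phi> \<in> dual_carrier X then \<phi> (v n) else 0)" for n \<phi>
  have "cmod (u n \<phi>) \<le> (if \<phi> \<in> dual_carrier X then vnorm (dual X) \<phi> else 0)" for n \<phi>
    using norm_le_dual_norm[OF nonneg _ v] by (simp add: u_def del: dual_simps)
  from bounded_sequence_pointwise_subnet[of u, OF this]
  obtain L G where G: "G \<noteq> bot" "G \<le> sequentially"
    and L: "\<And>\<phi>. ((\<lambda>n. u n \<phi>) \<longlongrightarrow> L \<phi>) G"
    by blast
  define F where "F = restrict L (dual_carrier X)"
  have F: "((\<lambda>n. \<phi> (v n)) \<longlongrightarrow> F \<phi>) G" if "\<phi> \<in> dual_carrier X" for \<phi>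
    using L[of \<phi>] that by (simp add: u_def F_def)
  have "F (vadd (dual X) \<phi> \<psi>) = F \<phi> + F \<psi>"
    if \<phi>\<psi>: "\<phi> \<in> dual_carrier X" "\<psi> \<in> dual_carrier X" for \<phi> \<psi>
  proof -
    obtain K M where "\<And>x. x \<in> vcarrier X \<Longrightarrow> cmod (\<phi> x) \<le> K * vnorm X x"
      "\<And>x. x \<in> vcarrier X \<Longrightarrow> cmod (\<psi> x) \<le> M * vnorm X x"
      using \<phi>\<psi> unfolding dual_carrier_def by blast
    then have "\<And>x. x \<in> vcarrier X \<Longrightarrow> cmod (\<phi> x + \<psi> x) \<le> (K + M) * vnorm X x"
      by (simp add: distrib_right add_mono norm_triangle_le)
    then have "\<exists>K. \<forall>x\<in>vcarrier X. cmod (\<phi> x + \<psi> x) \<le> K * vnorm X x"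
      by blast
    \<comment> \<open>\<open>F\<close> is a limit only at members of the dual, so the sum must first
      be shown to be one.\<close>
    then have mem: "vadd (dual X) \<phi> \<psi> \<in> dual_carrier X"
      using \<phi>\<psi> add scale by (auto simp: dual_carrier_def distrib_left)
    have "((\<lambda>n. \<phi> (v n) + \<psi> (v n)) \<longlongrightarrow> F (vadd (dual X) \<phi> \<psi>)) G"
      using F[OF mem] v by simp
    moreover have "((\<lambda>n. \<phi> (v n) + \<psi> (v n)) \<longlongrightarrow> F \<phi> + F \<psi>) G"
      by (intro tendsto_add F \<phi>\<psi>)
    ultimately show ?thesis
      using G tendsto_unique by blast
  qed
  moreover have "F (vscale (dual X) c \<phi>) = c * F \<phi>" if \<phi>: "\<phi> \<in> dual_carrier X" for c \<phi>
  proof -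
    obtain K where "\<And>x. x \<in> vcarrier X \<Longrightarrow> cmod (\<phi> x) \<le> K * vnorm X x"
      using \<phi> unfolding dual_carrier_def by blast
    then have "\<And>x. x \<in> vcarrier X \<Longrightarrow> cmod (c * \<phi> x) \<le> (cmod c * K) * vnorm X x"
      by (simp add: norm_mult mult.assoc mult_left_mono)
    then have "\<exists>K. \<forall>x\<in>vcarrier X. cmod (c * \<phi> x) \<le> K * vnorm X x"
      by blast
    then have mem: "vscale (dual X) c \<phi> \<in> dual_carrier X"
      using \<phi> add scale by (auto simp: dual_carrier_def distrib_left mult.left_commute)
    have "((\<lambda>n. c * \<phi> (v n)) \<longlongrightarrow> F (vscale (dual X) c \<phi>)) G"
      using F[OF mem] v by simp
    moreover have "((\<lambda>n. c * \<phi> (v n)) \<longlongrightarrow> c * F \<phi>) G"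
      by (intro tendsto_mult tendsto_const F \<phi>)
    ultimately show ?thesis
      using G tendsto_unique by blast
  qed
  moreover have "cmod (F \<phi>) \<le> 1 * vnorm (dual X) \<phi>" if \<phi>: "\<phi> \<in> dual_carrier X" for \<phi>
    using tendsto_upperbound[OF tendsto_norm[OF F[OF \<phi>]] _ G(1), of "vnorm (dual X) \<phi>"]
      norm_le_dual_norm[OF nonneg \<phi> v] by (simp del: dual_simps)
  moreover have "F \<in> extensional (dual_carrier X)"
    by (simp add: F_def)
  ultimately have "F \<in> dual_carrier (dual X)"
    unfolding dual_carrier_def[of "dual X"] dual_simps(1) by blast
  with G F that show thesis by blast
qed

section \<open>From weak-star continuity to weak continuity\<close>

text \<open>A composition of three maps: \<open>\<delta>\<close> is continuous into the weak-star
  topology by \<open>pointwise\<close>, the identity is weak-star to weak continuous at each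
  \<open>\<delta> x\<close> by \<open>cont\<close>, and \<open>F\<close> is weakly
  continuous.\<close>

lemma continuous_on_weak_of_topcontinuous_at:
  fixes \<delta> :: "'a::topological_space \<Rightarrow> 'v \<Rightarrow> complex"
  assumes cont: "\<And>x. topcontinuous_at
        (subtopology (weak_star_topology X) (unit_sphere (dual X)))
        (subtopology (weak_topology (dual X)) (unit_sphere (dual X))) id (\<delta> x)"
    and pointwise: "\<And>v. v \<in> vcarrier X \<Longrightarrow> continuous_on UNIV (\<lambda>x. \<delta> x v)"
    and F: "F \<in> dual_carrier (dual X)"
  shows "continuous_on UNIV (\<lambda>x. F (\<delta> x))"
proof -
  have "\<exists>T. open T \<and> x \<in> T \<and> (\<forall>y\<in>T. F (\<delta> y) \<in> W)" if W: "open W" "F (\<delta> x) \<in> W" for x W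
  proof -
    let ?S = "unit_sphere (dual X)"
    have sphere: "\<delta> y \<in> ?S" for y
      using cont[of y] by (simp add: topcontinuous_at_def)
    have \<delta>: "\<delta> y \<in> dual_carrier X" for y
      using sphere[of y] by (simp add: unit_sphere_def)
    let ?V = "{\<phi> \<in> dual_carrier X. F \<phi> \<in> W}"
    let ?P = "product_topology (\<lambda>_. euclidean :: complex topology) (dual_carrier (dual X))"
    let ?U = "{\<xi> \<in> topspace ?P. \<xi> F \<in> W}"
    have "openin euclidean W"
      using W(1) open_openin by blast
    with continuous_map_product_coordinates[OF F] have "openin ?P ?U"
      by (rule openin_continuous_map_preimage)
    \<comment> \<open>The weak topology is pulled back from a product indexed by the bidual, and
      \<open>F\<close> is one of its coordinates.\<close>
    moreover have "?V = (\<lambda>\<phi>. \<lambda>\<xi>\<in>dual_carrier (dual X). \<xi> \<phi>) -` ?U \<inter> dual_carrier X"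
      using F by auto
    ultimately have "openin (weak_topology (dual X)) ?V"
      unfolding weak_topology_def openin_pullback_topology dual_simps(1) by blast
    then have "openin (subtopology (weak_topology (dual X)) ?S) (?V \<inter> ?S)"
      by (auto simp: openin_subtopology)
    moreover have "id (\<delta> x) \<in> ?V \<inter> ?S"
      using W(2) sphere \<delta> by simp
    ultimately have "\<exists>U. openin (subtopology (weak_star_topology X) ?S) U \<and> \<delta> x \<in> U
        \<and> (\<forall>\<phi>\<in>U. id \<phi> \<in> ?V \<inter> ?S)"
      using cont[of x, unfolded topcontinuous_at_def, THEN conjunct2, THEN conjunct2,
          THEN spec[of _ "?V \<inter> ?S"]] by (rule mp[rotated, OF conjI])
    then obtain U where U: "openin (subtopology (weak_star_topology X) ?S) U"
      "\<delta> x \<in> U" "\<And>\<phi>. \<phi> \<in> U \<Longrightarrow> \<phi> \<in> ?V \<inter> ?S"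
      unfolding id_apply by blast
    let ?Q = "product_topology (\<lambda>_. euclidean :: complex topology) (vcarrier X)"
    obtain O' where O': "openin ?Q O'" "U = O' \<inter> dual_carrier X \<inter> ?S"
      using U(1) by (auto simp: weak_star_topology_def openin_subtopology)
    have "continuous_map euclidean ?Q \<delta>"
      using pointwise \<delta> by (auto simp: continuous_map_componentwise dual_carrier_def)
    then have "openin euclidean {y \<in> topspace euclidean. \<delta> y \<in> O'}"
      using O'(1) by (rule openin_continuous_map_preimage)
    then have "open {y. \<delta> y \<in> O'}"
      by (subst open_openin) simp
    moreover have "x \<in> {y. \<delta> y \<in> O'}"
      using U(2) O'(2) by simp
    moreover have "F (\<delta> y) \<in> W" if "y \<in> {y. \<delta> y \<in> O'}" for y
      using U(3)[of "\<delta> y"] that O'(2) sphere \<delta> by simp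
    ultimately show ?thesis by blast
  qed
  then show ?thesis
    unfolding continuous_on_topological by (metis UNIV_I)
qed

section \<open>Function algebras and their idempotents\<close>

locale complex_function_algebra =
  fixes A :: "('a::t2_space \<Rightarrow>\<^sub>C complex) set"
  assumes function_algebra: "function_algebra A"
begin

lemma compact_UNIV: "compact (UNIV :: 'a set)"
  and closed: "closed A"
  and add_mem: "f \<in> A \<Longrightarrow> g \<in> A \<Longrightarrow> f + g \<in> A"
  and scale_mem: "f \<in> A \<Longrightarrow> bcont_scale c f \<in> A"
  and mult_mem: "f \<in> A \<Longrightarrow> g \<in> A \<Longrightarrow> bcont_mult f g \<in> A"
  and const_mem: "const_bcontfun c \<in> A"
  and separation: "x \<noteq> y \<Longrightarrow> \<exists>f\<in>A. f x \<noteq> f y"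
  using function_algebra by (auto simp: function_algebra_def)

lemma diff_mem: "f \<in> A \<Longrightarrow> g \<in> A \<Longrightarrow> f - g \<in> A"
  using add_mem[OF _ scale_mem[of g "-1"], of f]
  by (metis (no_types, lifting) apply_bcont_scale bcontfun_eqI diff_conv_add_uminus
      minus_bcontfun.rep_eq mult_minus1 plus_bcontfun.rep_eq)

lemma sum_mem: "(\<And>i. i \<in> I \<Longrightarrow> f i \<in> A) \<Longrightarrow> (\<Sum>i\<in>I. f i) \<in> A"
  using const_mem[of 0] by (induction I rule: infinite_finite_induct) (auto intro: add_mem)

lemma apply_sum: "apply_bcontfun (\<Sum>i\<in>I. f i) x = (\<Sum>i\<in>I. apply_bcontfun (f i :: 'a \<Rightarrow>\<^sub>C complex) x)"
  by (induction I rule: infinite_finite_induct) auto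

lemma powers_mem:
  assumes "f \<in> A"
  obtains p where "\<And>n. p n \<in> A" "\<And>n x. apply_bcontfun (p n) x = apply_bcontfun f x ^ n"
proof
  show "((bcont_mult f) ^^ n) (const_bcontfun 1) \<in> A" for n
    by (induction n) (auto simp: const_mem mult_mem assms)
  show "apply_bcontfun (((bcont_mult f) ^^ n) (const_bcontfun 1)) x = apply_bcontfun f x ^ n" for n x
    by (induction n) auto
qed

lemma uniform_limit_mem:
  assumes "\<And>n. f n \<in> A" and lim: "uniform_limit UNIV (\<lambda>n. apply_bcontfun (f n)) l sequentially"
  obtains g where "g \<in> A" "apply_bcontfun g = l"
proof -
  obtain g where "l = apply_bcontfun g" "f \<longlonglongrightarrow> g"
    using uniform_limit_bcontfunE[OF lim] by auto
  then show thesis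
    using that closed assms(1) closed_sequentially by blast
qed

lemma max_modulus_attained:
  obtains z where "\<And>x. cmod (apply_bcontfun f x) \<le> cmod (apply_bcontfun f (z::'a))"
proof -
  have "continuous_on UNIV (\<lambda>x. cmod (apply_bcontfun f (x::'a)))"
    by (intro continuous_intros) auto
  then show thesis
    using continuous_attains_sup[OF compact_UNIV] that by blast
qed

text \<open>A continuous idempotent takes only the values 0 and 1, so it is determined by its
  support. Passing to supports makes inclusion the order on idempotents.\<close>

definition idempotent_sets :: "'a set set" where
  "idempotent_sets = {E. \<exists>e\<in>A. \<forall>x. apply_bcontfun e x = indicator E x}"

lemma idempotent_sets_UNIV: "UNIV \<in> idempotent_sets"
  using const_mem[of 1] by (auto simp: idempotent_sets_def intro!: bexI)

lemma idempotent_sets_Diff: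
  assumes "D \<in> idempotent_sets" "E \<in> idempotent_sets" "E \<subseteq> D"
  shows "D - E \<in> idempotent_sets"
proof -
  obtain d e where "d \<in> A" "\<And>x. apply_bcontfun d x = indicator D x"
    "e \<in> A" "\<And>x. apply_bcontfun e x = indicator E x"
    using assms by (auto simp: idempotent_sets_def)
  then show ?thesis
    using \<open>E \<subseteq> D\<close> unfolding idempotent_sets_def
    by (intro CollectI bexI[of _ "d - e"]) (auto intro: diff_mem simp: indicator_def)
qed

text \<open>Such sets are in fact clopen: their complements are again of this kind, by
  \<open>idempotent_sets_Diff\<close>.\<close>

lemma open_idempotent_sets:
  assumes "E \<in> idempotent_sets"
  shows "open E"
proof -
  obtain e where e: "e \<in> A" "\<And>x. apply_bcontfun e x = indicator E x"
    using assms unfolding idempotent_sets_def by blast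
  have "E = apply_bcontfun e -` (- {0})"
    by (auto simp: e indicator_def split: if_splits)
  moreover have "open (apply_bcontfun e -` (- {0}))"
    using continuous_on_apply_bcontfun[of UNIV e] by (intro open_vimage) auto
  ultimately show ?thesis by simp
qed

end

section \<open>Peak sets under smoothness\<close>

locale smooth_function_algebra = complex_function_algebra +
  assumes smooth: "weakly_Hahn_Banach_smooth (sup_norm_space A)"
begin

definition point_evaluation :: "'a \<Rightarrow> ('a \<Rightarrow>\<^sub>C complex) \<Rightarrow> complex" where
  "point_evaluation x = (\<lambda>f\<in>A. apply_bcontfun f x)"

lemma sup_norm_space_simps [simp]:
  "vcarrier (sup_norm_space A) = A" "vadd (sup_norm_space A) = (+)"
  "vscale (sup_norm_space A) = bcont_scale" "vnorm (sup_norm_space A) = norm"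
  by (simp_all add: sup_norm_space_def)

lemma point_evaluation_mem: "point_evaluation x \<in> dual_carrier (sup_norm_space A)"
  unfolding dual_carrier_def
  by (auto simp: point_evaluation_def add_mem scale_mem norm_bounded intro!: exI[of _ 1])

text \<open>The constant 1 has norm 1 and is mapped to 1. It shows both that the dual norm is 1 and
  that it is attained, so smoothness applies.\<close>

lemma topcontinuous_at_point_evaluation:
  fixes X defines "X \<equiv> sup_norm_space A"
  shows "topcontinuous_at
      (subtopology (weak_star_topology X) (unit_sphere (dual X)))
      (subtopology (weak_topology (dual X)) (unit_sphere (dual X))) id (point_evaluation x)"
proof -
  let ?B = "{f \<in> A. norm f \<le> 1}"
  have "norm (const_bcontfun 1 :: 'a \<Rightarrow>\<^sub>C complex) \<le> 1"
    by (rule norm_bound) simp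
  moreover have "1 \<le> norm (const_bcontfun 1 :: 'a \<Rightarrow>\<^sub>C complex)"
    using norm_bounded[of "const_bcontfun 1 :: 'a \<Rightarrow>\<^sub>C complex" x] by simp
  ultimately have one: "norm (const_bcontfun 1 :: 'a \<Rightarrow>\<^sub>C complex) = 1"
    by simp
  have "(SUP f\<in>?B. cmod (point_evaluation x f)) = 1"
  proof (rule cSup_eq_maximum)
    show "1 \<in> (\<lambda>f. cmod (point_evaluation x f)) ` ?B"
      using one const_mem[of 1]
      by (intro image_eqI[of _ _ "const_bcontfun 1"]) (auto simp: point_evaluation_def)
  qed (auto simp: point_evaluation_def intro: order_trans[OF norm_bounded])
  then have "point_evaluation x \<in> unit_sphere (dual X)"
    using point_evaluation_mem by (simp add: X_def unit_sphere_def)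
  moreover have "norm_attaining X (point_evaluation x)"
    unfolding norm_attaining_def unit_sphere_def X_def using one const_mem[of 1]
    by (intro bexI[of _ "const_bcontfun 1"]) (auto simp: point_evaluation_def)
  ultimately show ?thesis
    using smooth by (simp add: weakly_Hahn_Banach_smooth_def X_def)
qed

text \<open>The indicator of the peak set is x |-> F(evaluation at x) for a cluster point F of the
  powers of f, hence continuous. The hypothesis \<open>peak\<close> excludes other unimodular
  values, whose powers would not converge.\<close>

lemma open_peak_set:
  assumes f: "f \<in> A" "\<And>x. cmod (apply_bcontfun f x) \<le> 1"
    and peak: "\<And>x. cmod (apply_bcontfun f x) = 1 \<Longrightarrow> apply_bcontfun f x = 1"
  shows "open {x. apply_bcontfun f x = 1}"
proof -
  obtain p where p_mem: "\<And>n. p n \<in> A"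
    and p_apply: "\<And>n x. apply_bcontfun (p n) x = apply_bcontfun f x ^ n"
    using powers_mem[OF f(1)] by blast
  have p_norm: "norm (p n) \<le> 1" for n
    by (rule norm_bound) (simp add: p_apply norm_power f power_le_one)
  obtain F G where F: "F \<in> dual_carrier (dual (sup_norm_space A))"
    and G: "G \<noteq> bot" "G \<le> sequentially"
    and lim: "\<And>\<phi>. \<phi> \<in> dual_carrier (sup_norm_space A) \<Longrightarrow> ((\<lambda>n. \<phi> (p n)) \<longlongrightarrow> F \<phi>) G"
    by (rule bidual_cluster_point[of "sup_norm_space A" p])
      (simp_all add: add_mem scale_mem p_mem p_norm)
  have "continuous_on UNIV (\<lambda>x. F (point_evaluation x))"
  proof (rule continuous_on_weak_of_topcontinuous_at[OF topcontinuous_at_point_evaluation _ F])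
    show "continuous_on UNIV (\<lambda>x. point_evaluation x g)"
      if "g \<in> vcarrier (sup_norm_space A)" for g
      using that by (simp add: point_evaluation_def)
  qed
  moreover have "F (point_evaluation x) = (if apply_bcontfun f x = 1 then 1 else 0)" for x
  proof -
    have "((\<lambda>n. apply_bcontfun f x ^ n) \<longlongrightarrow> F (point_evaluation x)) G"
      using lim[OF point_evaluation_mem[of x]] by (simp add: point_evaluation_def p_mem p_apply)
    \<comment> \<open>Off the peak set |f x| < 1. Ordinary convergence passes to the finer filter
      \<open>G\<close>, which identifies the limit.\<close>
    moreover have "(\<lambda>n. apply_bcontfun f x ^ n) \<longlonglongrightarrow> (if apply_bcontfun f x = 1 then 1 else 0)"
      using f(2)[of x] peak[of x] by (auto intro!: LIMSEQ_power_zero simp: order_less_le)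
    ultimately show ?thesis
      using G tendsto_mono tendsto_unique by blast
  qed
  ultimately have "continuous_on UNIV (\<lambda>x. if apply_bcontfun f x = 1 then 1 else 0 :: complex)"
    by simp
  then have "open ((\<lambda>x. if apply_bcontfun f x = 1 then 1 else 0 :: complex) -` (- {0}))"
    by (intro open_vimage) auto
  then show ?thesis
    by (simp add: vimage_def if_distrib[of "\<lambda>z. z \<noteq> 0"] if_bool_eq_conj cong: if_cong)
qed

text \<open>Since the peak set is open, its complement is compact and |f| has a maximum r < 1 there.
  So the powers of f converge to the indicator uniformly, at rate r^n.\<close>

lemma idempotent_of_strict_peak_set:
  assumes f: "f \<in> A" "\<And>x. cmod (apply_bcontfun f x) \<le> 1"
    and peak: "\<And>x. cmod (apply_bcontfun f x) = 1 \<Longrightarrow> apply_bcontfun f x = 1"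
  shows "{x. apply_bcontfun f x = 1} \<in> idempotent_sets"
proof -
  let ?E = "{x. apply_bcontfun f x = 1}"
  have "closed (- ?E)"
    using open_peak_set[OF assms] by blast
  then have compact: "compact (- ?E)"
    using compact_UNIV closed_Int_compact[of "- ?E" UNIV] by simp
  obtain r where r: "0 \<le> r" "r < 1" "\<And>x. x \<notin> ?E \<Longrightarrow> cmod (apply_bcontfun f x) \<le> r"
  proof (cases "- ?E = {}")
    case True
    then show ?thesis
      using that[of 0] by (metis ComplI empty_iff less_numeral_extra(1) order_refl)
  next
    case False
    have "continuous_on (- ?E) (\<lambda>x. cmod (apply_bcontfun f x))"
      by (intro continuous_intros) auto
    then obtain z where "z \<notin> ?E"
      "\<And>x. x \<notin> ?E \<Longrightarrow> cmod (apply_bcontfun f x) \<le> cmod (apply_bcontfun f z)"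
      using continuous_attains_sup[OF compact False]
      unfolding Compl_iff Ball_def Bex_def mem_Collect_eq by blast
    then show ?thesis
      using that[of "cmod (apply_bcontfun f z)"] f(2)[of z] peak[of z] by (auto simp: order_less_le)
  qed
  obtain p where p_mem: "\<And>n. p n \<in> A"
    and p_apply: "\<And>n x. apply_bcontfun (p n) x = apply_bcontfun f x ^ n"
    using powers_mem[OF f(1)] by blast
  have bound: "cmod (apply_bcontfun (p n) x - indicator ?E x) \<le> r ^ n" for n x
    using r by (auto simp: p_apply indicator_def norm_power intro!: power_mono)
  have "uniform_limit UNIV (\<lambda>n. apply_bcontfun (p n)) (indicator ?E) sequentially"
  proof (rule uniform_limitI)
    fix e :: real assume "e > 0"
    have "eventually (\<lambda>n. r ^ n < e) sequentially"
      using LIMSEQ_power_zero[of r] r \<open>e > 0\<close> by (intro order_tendstoD) auto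
    then show "\<forall>\<^sub>F n in sequentially. \<forall>x\<in>UNIV. dist (apply_bcontfun (p n) x) (indicator ?E x) < e"
      by eventually_elim (use bound in \<open>auto simp: dist_norm intro: le_less_trans\<close>)
  qed
  then obtain g where "g \<in> A" "apply_bcontfun g = indicator ?E"
    using uniform_limit_mem[of p] p_mem by blast
  then show ?thesis
    unfolding idempotent_sets_def mem_Collect_eq by metis
qed

lemma peak_set_idempotent:
  assumes f: "f \<in> A" "\<And>x. cmod (apply_bcontfun f x) \<le> 1"
  shows "{x. apply_bcontfun f x = 1} \<in> idempotent_sets"
proof -
  \<comment> \<open>Averaging with 1 keeps only the value 1 on the unit circle.\<close>
  define g where "g = bcont_scale (1/2) (const_bcontfun 1 + f)"
  have g: "apply_bcontfun g x = (1 + apply_bcontfun f x) / 2" for x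
    by (simp add: g_def)
  have half: "cmod ((1 + w) / 2) \<le> 1" "cmod ((1 + w) / 2) = 1 \<Longrightarrow> w = 1" if w: "cmod w \<le> 1" for w
  proof -
    have tri: "cmod (1 + w) \<le> 1 + cmod w"
      using norm_triangle_ineq[of 1 w] by simp
    then show "cmod ((1 + w) / 2) \<le> 1"
      using w by (simp add: norm_divide)
    assume "cmod ((1 + w) / 2) = 1"
    then have "cmod (1 + w) ^ 2 = 4" "cmod w ^ 2 = 1"
      using w tri by (auto simp: norm_divide)
    then have eqs: "(1 + Re w)\<^sup>2 + (Im w)\<^sup>2 = 4" "(Re w)\<^sup>2 + (Im w)\<^sup>2 = 1"
      unfolding cmod_power2 by simp_all
    \<comment> \<open>Subtracting the two equations leaves 1 + 2 Re w = 3.\<close>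
    then have "Re w = 1"
      by (simp add: power2_sum)
    with eqs(2) show "w = 1"
      by (simp add: complex_eq_iff)
  qed
  have "g \<in> A"
    by (simp add: g_def scale_mem add_mem const_mem f)
  then have "{x. apply_bcontfun g x = 1} \<in> idempotent_sets"
    by (rule idempotent_of_strict_peak_set) (use half f in \<open>auto simp: g\<close>)
  then show ?thesis
    by (simp add: g field_simps)
qed

section \<open>Countable unions and the descending chain condition\<close>

text \<open>The weighted sum s of the indicators lies in A, has values in [0,1] and vanishes exactly
  off the union. Hence 1 - s peaks exactly on the complement of the union.\<close>

lemma idempotent_sets_UN:
  assumes "\<And>k::nat. E k \<in> idempotent_sets"
  shows "(\<Union>k. E k) \<in> idempotent_sets"
proof -
  obtain e where e_mem: "\<And>k. e k \<in> A" and e: "\<And>k x. apply_bcontfun (e k) x = indicator (E k) x"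
    using assms unfolding idempotent_sets_def by simp metis
  have bound: "cmod ((1/2) ^ Suc k * indicator (E k) x) \<le> (1/2) ^ Suc k" for k and x :: 'a
    by (simp add: indicator_def norm_mult norm_power norm_divide)
  \<comment> \<open>Taken real so that it can be compared with 0 and 1; the complex series has the
    sum \<open>of_real (s x)\<close>. The weights add up to 1.\<close>
  define s :: "'a \<Rightarrow> real" where "s x = (\<Sum>k. (1/2) ^ Suc k * indicator (E k) x)" for x
  have summ: "summable (\<lambda>k. (1/2::real) ^ Suc k * indicator (E k) x)" for x
    by (rule summable_comparison_test'[OF sums_summable[OF power_half_series], of 0])
      (simp add: indicator_def)
  have s_sums: "(\<lambda>k. (1/2::complex) ^ Suc k * indicator (E k) x) sums of_real (s x)" for x
    using sums_of_real[OF summable_sums[OF summ[of x]], where 'a = complex]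
    by (simp add: s_def of_real_indicator)
  have "uniform_limit UNIV (\<lambda>n x. \<Sum>k<n. (1/2::complex) ^ Suc k * indicator (E k) x)
      (\<lambda>x. \<Sum>k. (1/2) ^ Suc k * indicator (E k) x) sequentially"
    by (rule Weierstrass_m_test[of _ _ "\<lambda>k. (1/2) ^ Suc k"])
      (use bound sums_summable[OF power_half_series] in auto)
  moreover have "(\<lambda>x. \<Sum>k. (1/2::complex) ^ Suc k * indicator (E k) x) = (\<lambda>x. of_real (s x))"
    using s_sums by (auto simp: sums_iff)
  moreover have "(\<lambda>n x. \<Sum>k<n. (1/2::complex) ^ Suc k * indicator (E k) x)
      = (\<lambda>n. apply_bcontfun (\<Sum>k<n. bcont_scale ((1/2) ^ Suc k) (e k)))"
    by (simp add: fun_eq_iff apply_sum e)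
  ultimately have "uniform_limit UNIV
      (\<lambda>n. apply_bcontfun (\<Sum>k<n. bcont_scale ((1/2) ^ Suc k) (e k))) (\<lambda>x. of_real (s x)) sequentially"
    by metis
  then obtain g where g: "g \<in> A" "apply_bcontfun g = (\<lambda>x. of_real (s x))"
    using uniform_limit_mem[of "\<lambda>n. \<Sum>k<n. bcont_scale ((1/2) ^ Suc k) (e k)"]
    by (metis (no_types, lifting) sum_mem scale_mem e_mem)
  have s_nonneg: "0 \<le> s x" for x
    unfolding s_def by (rule suminf_nonneg[OF summ]) simp
  have s_le: "s x \<le> 1" for x
  proof -
    have "s x \<le> (\<Sum>k. (1/2) ^ Suc k)"
      unfolding s_def
      by (rule suminf_le[OF _ summ sums_summable[OF power_half_series]]) (simp add: indicator_def)
    also have "\<dots> = 1"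
      using power_half_series by (simp add: sums_iff)
    finally show ?thesis .
  qed
  have s_zero: "s x = 0 \<longleftrightarrow> x \<notin> (\<Union>k. E k)" for x
    unfolding s_def by (subst suminf_eq_zero_iff[OF summ]) (auto simp: indicator_eq_0_iff)
  define h where "h = const_bcontfun 1 - g"
  have h: "apply_bcontfun h x = of_real (1 - s x)" for x
    by (simp add: h_def g)
  have "{x. apply_bcontfun h x = 1} \<in> idempotent_sets"
  proof (rule peak_set_idempotent)
    show "h \<in> A"
      by (simp add: h_def diff_mem const_mem g)
    show "cmod (apply_bcontfun h x) \<le> 1" for x
      unfolding h norm_of_real using s_nonneg[of x] s_le[of x] by simp
  qed
  moreover have "{x. apply_bcontfun h x = 1} = UNIV - (\<Union>k. E k)"
    using s_zero by (auto simp: h)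
  ultimately have "UNIV - (UNIV - (\<Union>k. E k)) \<in> idempotent_sets"
    using idempotent_sets_Diff[OF idempotent_sets_UNIV] by simp
  then show ?thesis
    by (simp add: double_diff)
qed

text \<open>The complements of a descending chain are open, and their union is closed by
  \<open>idempotent_sets_UN\<close>, hence compact. A finite subcover makes the chain
  stationary.\<close>

lemma wf_psubset_idempotent_sets:
  "wf {(D, E). D \<in> idempotent_sets \<and> E \<in> idempotent_sets \<and> D \<subset> E}"
  unfolding wf_iff_no_infinite_down_chain
proof safe
  fix E :: "nat \<Rightarrow> 'a set"
  assume "\<forall>i. (E (Suc i), E i) \<in> {(D, E). D \<in> idempotent_sets \<and> E \<in> idempotent_sets \<and> D \<subset> E}"
  then have E: "E k \<in> idempotent_sets" and strict: "E (Suc k) \<subset> E k" for k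
    by auto
  let ?C = "\<lambda>k. UNIV - E k"
  have C: "?C k \<in> idempotent_sets" for k
    using E idempotent_sets_Diff[OF idempotent_sets_UNIV] by simp
  have "open (UNIV - (\<Union>k. ?C k))"
    using open_idempotent_sets idempotent_sets_Diff[OF idempotent_sets_UNIV idempotent_sets_UN[of ?C]] C
    by blast
  then have "compact (\<Union>k. ?C k)"
    using compact_UNIV closed_Int_compact[of "\<Union>k. ?C k" UNIV] by (simp add: closed_def Compl_eq_Diff_UNIV)
  then obtain K where K: "finite K" "(\<Union>k. ?C k) \<subseteq> (\<Union>k\<in>K. ?C k)"
    by (rule compactE_image[of "\<Union>k. ?C k" UNIV ?C]) (simp_all add: open_idempotent_sets C)
  obtain m where m: "\<And>k. k \<in> K \<Longrightarrow> k \<le> m"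
    using that[of "Max K"] K(1) by simp
  have "E m \<subseteq> E k" if "k \<le> m" for k
    using strict by (intro lift_Suc_antimono_le[OF _ that]) (rule psubset_imp_subset)
  then have "E m \<subseteq> \<Inter>(E ` K)"
    using m by blast
  \<comment> \<open>A point outside \<open>E (Suc m)\<close> is covered by some \<open>?C k\<close>
    with k in \<open>K\<close>, so it lies outside \<open>E k\<close> and thus outside
    \<open>E m\<close>.\<close>
  then have "E m \<subseteq> E (Suc m)"
    using K(2) by blast
  with strict[of m] show False
    by blast
qed

text \<open>Multiplying f - f(y) by the indicator of E gives g in A that vanishes at y and off E,
  but not at x. Dividing g by its value at a point z of maximal modulus gives a function whose peak
  set contains z, misses y and stays inside E.\<close>

lemma idempotent_sets_split:
  assumes E: "E \<in> idempotent_sets" and xy: "x \<in> E" "y \<in> E" "x \<noteq> y"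
  obtains P where "P \<in> idempotent_sets" "P \<subset> E" "P \<noteq> {}"
proof -
  obtain e where e: "e \<in> A" "\<And>x. apply_bcontfun e x = indicator E x"
    using E by (auto simp: idempotent_sets_def)
  obtain f where f: "f \<in> A" "apply_bcontfun f x \<noteq> apply_bcontfun f y"
    using separation[OF xy(3)] by blast
  define g where "g = bcont_mult e (f - const_bcontfun (apply_bcontfun f y))"
  have g_mem: "g \<in> A"
    by (simp add: g_def mult_mem diff_mem const_mem e f)
  have g: "apply_bcontfun g w = indicator E w * (apply_bcontfun f w - apply_bcontfun f y)" for w
    by (simp add: g_def e)
  obtain z where z: "\<And>w. cmod (apply_bcontfun g w) \<le> cmod (apply_bcontfun g z)"
    using max_modulus_attained by blast
  have "apply_bcontfun g x \<noteq> 0"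
    using xy f by (simp add: g)
  then have gz: "apply_bcontfun g z \<noteq> 0"
    using z[of x] by auto
  let ?h = "bcont_scale (1 / apply_bcontfun g z) g"
  let ?P = "{w. apply_bcontfun ?h w = 1}"
  have "?P \<in> idempotent_sets"
    using z gz by (intro peak_set_idempotent scale_mem g_mem) (simp add: norm_divide)
  moreover have "?P \<subset> E"
  proof
    show "?P \<subseteq> E"
      by (auto simp: g indicator_def split: if_splits)
    have "apply_bcontfun g y = 0"
      by (simp add: g)
    then have "y \<notin> ?P"
      by simp
    with xy(2) show "?P \<noteq> E"
      by metis
  qed
  moreover have "z \<in> ?P"
    using gz by simp
  then have "?P \<noteq> {}"
    by (rule ex_in_conv[THEN iffD1, OF exI])
  ultimately show thesis
    by (rule that)
qed

section \<open>Finiteness of the space and the isometry\<close>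

lemma singleton_idempotent: "{x} \<in> idempotent_sets"
proof -
  let ?Q = "{E \<in> idempotent_sets. x \<in> E}"
  have "UNIV \<in> ?Q"
    using idempotent_sets_UNIV by simp
  with wf_psubset_idempotent_sets obtain E where E: "E \<in> ?Q"
    and minimal: "\<And>D. (D, E) \<in> {(D, E). D \<in> idempotent_sets \<and> E \<in> idempotent_sets \<and> D \<subset> E}
      \<Longrightarrow> D \<notin> ?Q"
    by (rule wfE_min) blast
  have "E = {x}"
  proof (rule ccontr)
    assume "E \<noteq> {x}"
    then obtain y where "y \<in> E" "x \<noteq> y"
      using E by blast
    then obtain P where P: "P \<in> idempotent_sets" "P \<subset> E" "P \<noteq> {}"
      using idempotent_sets_split[of E x y] E by blast
    then have "E - P \<in> idempotent_sets" "E - P \<subset> E"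
      using E idempotent_sets_Diff[of E P] by auto
    \<comment> \<open>The point x lies in \<open>P\<close> or in \<open>E - P\<close>, and either
      one would be a smaller member of \<open>?Q\<close>.\<close>
    then show False
      using minimal[of P] minimal[of "E - P"] P E by blast
  qed
  with E show ?thesis by simp
qed

text \<open>Open singletons make the space discrete, and a compact discrete space is finite.\<close>

lemma finite_points: "finite (UNIV :: 'a set)"
proof -
  obtain K where "finite K" "(UNIV :: 'a set) \<subseteq> (\<Union>x\<in>K. {x})"
    by (rule compactE_image[OF compact_UNIV, of UNIV "\<lambda>x. {x}"])
      (simp_all add: open_idempotent_sets singleton_idempotent)
  then show ?thesis
    using finite_subset by fastforce
qed

text \<open>On a finite space f is the combination of the indicators of points with coefficients
  f(y), and these indicators lie in A.\<close>

lemma mem_of_finite: "f \<in> A"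
proof -
  have "\<forall>y. \<exists>e. e \<in> A \<and> (\<forall>x. apply_bcontfun e x = indicator {y} x)"
    using singleton_idempotent unfolding idempotent_sets_def by auto
  then obtain e where e: "\<And>y. e y \<in> A" "\<And>y x. apply_bcontfun (e y) x = indicator {y} x"
    by metis
  have "f = (\<Sum>y\<in>UNIV. bcont_scale (apply_bcontfun f y) (e y))"
  proof (rule bcontfun_eqI)
    fix x
    have "(\<Sum>y\<in>UNIV. apply_bcontfun f y * indicator {y} x)
        = (\<Sum>y\<in>UNIV. if y = x then apply_bcontfun f y else 0)"
      by (intro sum.cong) (auto simp: indicator_def)
    then show "apply_bcontfun f x
        = apply_bcontfun (\<Sum>y\<in>UNIV. bcont_scale (apply_bcontfun f y) (e y)) x"
      using finite_points by (simp add: apply_sum e)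
  qed
  then show ?thesis
    using sum_mem[of UNIV "\<lambda>y. bcont_scale (apply_bcontfun f y) (e y)"] scale_mem[OF e(1)]
    by simp
qed

lemma bcontfun_of_finite: "\<exists>f. apply_bcontfun f = (g :: 'a \<Rightarrow> complex)"
proof -
  have "continuous_on UNIV g"
    using open_idempotent_sets[OF singleton_idempotent] unfolding continuous_on_topological
    by (metis singletonD insertI1)
  moreover have "cmod (g x) \<le> Max (range (\<lambda>x. cmod (g x)))" for x
    using finite_points by (intro Max_ge) auto
  ultimately show ?thesis
    by (metis bcontfunE bcontfun_normI)
qed

lemma linearly_isometric_ell_infinity:
  "linearly_isometric (sup_norm_space A) (ell_infinity (card (UNIV :: 'a set)))"
proof -
  let ?n = "card (UNIV :: 'a set)"
  obtain b where b: "bij_betw b {..<?n} (UNIV :: 'a set)"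
    using ex_bij_betw_nat_finite[OF finite_points] by (auto simp: lessThan_atLeast0)
  have n: "?n > 0"
    using finite_points by (simp add: card_gt_0_iff)
  define T where "T f = (\<lambda>i\<in>{..<?n}. apply_bcontfun f (b i))" for f :: "'a \<Rightarrow>\<^sub>C complex"
  have "inj_on T A"
  proof (intro inj_onI bcontfun_eqI)
    fix f g x assume "T f = T g"
    obtain i where "i < ?n" "x = b i"
      using b by (auto simp: bij_betw_def)
    then show "apply_bcontfun f x = apply_bcontfun g x"
      using fun_cong[OF \<open>T f = T g\<close>, of i] by (simp add: T_def)
  qed
  moreover have "v \<in> T ` A" if "v \<in> extensional {..<?n}" for v
  proof -
    \<comment> \<open>A preimage of \<open>v\<close> under \<open>T\<close> is \<open>v\<close>
      composed with the inverse of the enumeration \<open>b\<close>; discreteness makes it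
      continuous.\<close>
    obtain f where f: "apply_bcontfun f = (\<lambda>x. v (the_inv_into {..<?n} b x))"
      using bcontfun_of_finite by blast
    have "T f = v"
      using that b unfolding T_def f
      by (intro extensionalityI[of _ "{..<?n}"]) (auto simp: the_inv_into_f_f bij_betw_def)
    then show ?thesis
      using mem_of_finite by blast
  qed
  moreover have "Max ((\<lambda>i. cmod (T f i)) ` {..<?n}) = norm f" for f
  proof -
    obtain z where z: "\<And>x. cmod (apply_bcontfun f x) \<le> cmod (apply_bcontfun f z)"
      using max_modulus_attained by blast
    then have "norm f = cmod (apply_bcontfun f z)"
      by (intro antisym norm_bound norm_bounded)
    moreover obtain i where "i < ?n" "z = b i"
      using b by (auto simp: bij_betw_def)
    ultimately show ?thesis
      using z by (intro Max_eqI) (auto simp: T_def)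
  qed
  ultimately show ?thesis
    unfolding linearly_isometric_def ell_infinity_def
    by (intro exI[of _ T]) (auto simp: bij_betw_def T_def fun_eq_iff)
qed

end

theorem theorem10:
  fixes A :: "('a::t2_space \<Rightarrow>\<^sub>C complex) set"
  assumes "function_algebra A"
    and "weakly_Hahn_Banach_smooth (sup_norm_space A)"
  shows "\<exists>n::nat. n > 0 \<and> linearly_isometric (sup_norm_space A) (ell_infinity n)"
proof -
  interpret smooth_function_algebra A
    using assms by unfold_locales
  \<comment> \<open>The cardinality is positive because the type of points is nonempty.\<close>
  show ?thesis
    using linearly_isometric_ell_infinity finite_points
    by (intro exI[of _ "card (UNIV :: 'a set)"]) (simp add: card_gt_0_iff)
qed

end
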